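(* For all $\delta>0$ and $\epsilon>0$, the algorithm B-EquiSet (with any choice of the arbitrary splits $r_{j,i}(t)$ it is allowed to make) is a $(1+\delta)(4+\epsilon)$-speed $(2+8/\epsilon)(1+1/\delta)$-competitive algorithm for the online data broadcast problem with dependencies. That is, for every instance $\mathcal{S}$, the flow time of the schedule produced by B-EquiSet with bandwidth $s=(1+\delta)(4+\epsilon)$ is at most $(2+8/\epsilon)(1+1/\delta)\cdot \mathrm{BOPT}_1(\mathcal{S})$.
   Context: Online data broadcast problem with dependencies. An instance $\mathcal{S}$ consists of a set of $n$ items $I_1,\dots,I_n$ with lengths $\ell_1,\dots,\ell_n>0$, and $q$ requests for non-empty sets of items $S_1,\dots,S_q\subseteq\{I_1,\dots,I_n\}$ with arrival times $a_1,\dots,a_q\ge 0$. An $s$-speed schedule is a function $r:\{I_1,\dots,I_n\}\times[0,\infty)\to[0,s]$ with $\sum_i r(I_i,t)\le s$ for all $t$; $r(I_i,t)$ is the rate (bandwidth) at which $I_i$ is broadcast at time $t$. Let $c(I_i,0)=0$ and $c(I_i,k)$ be the first date with $\int_0^{c(I_i,k)} r(I_i,t)\,dt=k\ell_i$ (end of the $k$-th broadcast of $I_i$), and $b(I_i,k)=\inf\{t\ge c(I_i,k-1): r(I_i,t)>0\}$ (start of the $k$-th broadcast). For a time $t$, let $C(I_i,t)=\min\{c(I_i,k): b(I_i,k)\ge t\}$ (end of the first broadcast of $I_i$ starting at or after $t$; a request cannot download an item whose broadcast started before its arrival). The completion time of $S_j$ is $c_j=\max_{I_i\in S_j} C(I_i,a_j)$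 and the flow time of the schedule is $\sum_{j}(c_j-a_j)$. $\mathrm{BOPT}_s(\mathcal{S})$ denotes the minimum flow time over all $s$-speed schedules. An algorithm is online and non-clairvoyant: it learns request $S_j$ only at time $a_j$, does not know item lengths, and learns that a broadcast is complete only when it completes. An algorithm is $s$-speed $c$-competitive if on every instance its flow time when given bandwidth $s$ is at most $c$ times $\mathrm{BOPT}_1$. B-EquiSet with bandwidth $s$: a request $S_j$ is alive at time $t$ if $t\ge a_j$ and some $I_i\in S_j$ has $t<C(I_i,a_j)$; such an item $I_i$ is alive for $S_j$ at time $t$. Let $R(t)$ be the set of alive requests. At each time $t$, each alive request receives bandwidth $s/|R(t)|$, which is split arbitrarily among its alive items: rates $r_{j,i}(t)\ge0$ for $I_i$ alive for $S_j$, with $\sum_{I_i \text{ alive for } S_j} r_{j,i}(t)=s/|R(t)|$. Item $I_i$ is broadcast at rate $r_i(t)=\sum_{S_j\in R(t):\, I_i \text{ alive for } S_j} r_{j,i}(t)$. *)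

theory Defs
  imports "HOL-Analysis.Analysis"
begin

text \<open>Items are numbered \<open>1..num_items\<close> and requests \<open>1..num_requests\<close>; the values of the
  remaining fields outside these ranges are irrelevant.\<close>

record broadcast_instance =
  num_items :: nat
  len :: "nat \<Rightarrow> real"
  num_requests :: nat
  req :: "nat \<Rightarrow> nat set"
  arr :: "nat \<Rightarrow> real"

abbreviation items :: "broadcast_instance \<Rightarrow> nat set" where
  "items P \<equiv> {1..num_items P}"

abbreviation requests :: "broadcast_instance \<Rightarrow> nat set" where
  "requests P \<equiv> {1..num_requests P}"

definition valid_instance :: "broadcast_instance \<Rightarrow> bool" where
  "valid_instance P \<longleftrightarrow>
     (\<forall>i\<in>items P. 0 < len P i) \<and>
     (\<forall>j\<in>requests P. req P j \<noteq> {} \<and> req P j \<subseteq> items P \<and> 0 \<le> arr P j)"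

text \<open>\<open>r i t\<close> is the rate of item \<open>i\<close> at time \<open>t\<close>; only \<open>t \<ge> 0\<close> matters. Integrability on bounded
  intervals (for these bounded functions: measurability) makes the broadcast volumes meaningful.\<close>

type_synonym schedule = "nat \<Rightarrow> real \<Rightarrow> real"

definition is_schedule :: "broadcast_instance \<Rightarrow> real \<Rightarrow> schedule \<Rightarrow> bool" where
  "is_schedule P s r \<longleftrightarrow>
     (\<forall>i\<in>items P. \<forall>t\<ge>0. 0 \<le> r i t \<and> r i t \<le> s) \<and>
     (\<forall>t\<ge>0. (\<Sum>i\<in>items P. r i t) \<le> s) \<and>
     (\<forall>i\<in>items P. \<forall>T\<ge>0. r i integrable_on {0..T})"

text \<open>Dates are extended reals: a broadcast that never ends (or never starts) has date \<open>\<infinity>\<close>, the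
  infimum of the empty set. In \<open>broadcast_end\<close> the infimum of a nonempty set is a minimum, because
  the volume broadcast up to time \<open>t\<close> is continuous in \<open>t\<close>.\<close>

definition broadcast_end :: "broadcast_instance \<Rightarrow> schedule \<Rightarrow> nat \<Rightarrow> nat \<Rightarrow> ereal" where
  "broadcast_end P r i k =
     (if k = 0 then 0
      else Inf {ereal t |t. 0 \<le> t \<and> integral {0..t} (r i) = real k * len P i})"

text \<open>Meaningful for \<open>k \<ge> 1\<close> only.\<close>

definition broadcast_start :: "broadcast_instance \<Rightarrow> schedule \<Rightarrow> nat \<Rightarrow> nat \<Rightarrow> ereal" where
  "broadcast_start P r i k =
     Inf {ereal t |t. broadcast_end P r i (k - 1) \<le> ereal t \<and> 0 < r i t}"

definition item_completion :: "broadcast_instance \<Rightarrow> schedule \<Rightarrow> nat \<Rightarrow> real \<Rightarrow> ereal" where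
  "item_completion P r i t =
     Inf {broadcast_end P r i k |k. 1 \<le> k \<and> ereal t \<le> broadcast_start P r i k}"

definition completion :: "broadcast_instance \<Rightarrow> schedule \<Rightarrow> nat \<Rightarrow> ereal" where
  "completion P r j = Max ((\<lambda>i. item_completion P r i (arr P j)) ` req P j)"

definition flow_time :: "broadcast_instance \<Rightarrow> schedule \<Rightarrow> ereal" where
  "flow_time P r = (\<Sum>j\<in>requests P. completion P r j - ereal (arr P j))"

definition BOPT :: "real \<Rightarrow> broadcast_instance \<Rightarrow> ereal" where
  "BOPT s P = Inf {flow_time P r |r. is_schedule P s r}"

definition alive_item :: "broadcast_instance \<Rightarrow> schedule \<Rightarrow> nat \<Rightarrow> real \<Rightarrow> nat \<Rightarrow> bool" where
  "alive_item P r j t i \<longleftrightarrow>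
     i \<in> req P j \<and> arr P j \<le> t \<and> ereal t < item_completion P r i (arr P j)"

definition alive_requests :: "broadcast_instance \<Rightarrow> schedule \<Rightarrow> real \<Rightarrow> nat set" where
  "alive_requests P r t = {j \<in> requests P. \<exists>i. alive_item P r j t i}"

text \<open>\<open>B_EquiSet P s r\<close>: the schedule \<open>r\<close> is a run of B-EquiSet with bandwidth \<open>s\<close> on \<open>P\<close> for some
  choice \<open>w\<close> of the splits, where \<open>w j i t\<close> is the part of the share of request \<open>j\<close> that goes to item
  \<open>i\<close> at time \<open>t\<close>. The set of alive items at time \<open>t\<close> refers to \<open>r\<close> itself, but only to its past:
  whether \<open>t < item_completion P r i (arr P j)\<close> depends on \<open>r i\<close> restricted to \<open>[0, t)\<close>.
  As \<open>w\<close> is a total function, it is set to \<open>0\<close> where item \<open>i\<close> is not alive for request \<open>j\<close>.\<close>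

definition B_EquiSet :: "broadcast_instance \<Rightarrow> real \<Rightarrow> schedule \<Rightarrow> bool" where
  "B_EquiSet P s r \<longleftrightarrow>
     (\<exists>w :: nat \<Rightarrow> nat \<Rightarrow> real \<Rightarrow> real.
        (\<forall>j\<in>requests P. \<forall>i\<in>items P. \<forall>T\<ge>0. w j i integrable_on {0..T}) \<and>
        (\<forall>t\<ge>0. \<forall>j\<in>requests P. \<forall>i\<in>items P.
           0 \<le> w j i t \<and> (\<not> alive_item P r j t i \<longrightarrow> w j i t = 0)) \<and>
        (\<forall>t\<ge>0. \<forall>j\<in>alive_requests P r t.
           (\<Sum>i | alive_item P r j t i. w j i t) = s / real (card (alive_requests P r t))) \<and>
        (\<forall>t\<ge>0. \<forall>i\<in>items P.
           r i t = (\<Sum>j | j \<in> alive_requests P r t \<and> alive_item P r j t i. w j i t)))"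

text \<open>An algorithm that makes arbitrary choices is given by the relation between instances,
  bandwidths and the schedules it may produce; the bound has to hold for all of them.\<close>

definition speed_competitive ::
  "(broadcast_instance \<Rightarrow> real \<Rightarrow> schedule \<Rightarrow> bool) \<Rightarrow> real \<Rightarrow> real \<Rightarrow> bool" where
  "speed_competitive A s c \<longleftrightarrow>
     (\<forall>P r. valid_instance P \<longrightarrow> A P s r \<longrightarrow> flow_time P r \<le> ereal c * BOPT 1 P)"

end

theory Submission imports Defs begin

text \<open>An amortized potential argument in integrated form. Call an alive request of B-EquiSet settled
  once the optimal schedule has completed it, and give it as potential its rank among the alive
  requests by arrival, times the work that it will still receive. Unless unsettled requests, which the
  optimum pays for, are numerous, equal sharing drains this potential at rate about \<open>s n / 2\<close> when
  \<open>n\<close> requests are alive. The potential is filled while the optimum broadcasts: every request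
  has seen a full broadcast of each of its items in the optimal schedule, and all the work that
  B-EquiSet does on an item after time \<open>t\<close> for requests that arrived by time \<open>t\<close> amounts to at most two
  broadcasts, so the filling rate is at most \<open>2 n\<close>. Hence
  \<open>(s / 2 - 2) \<integral>n \<le> s \<cdot> OPT\<close> for every \<open>s\<close>, which for \<open>s = 4 + \<epsilon>\<close> already gives the
  ratio \<open>2 + 8 / \<epsilon>\<close>.\<close>

section \<open>Integrals over time windows and a counting inequality\<close>

lemma has_integral_indicator_halfopen:
  fixes a c T :: real
  assumes "0 \<le> a" "a \<le> c" "c \<le> T"
  shows "((\<lambda>t. if a \<le> t \<and> t < c then 1 else 0) has_integral (c - a)) {0..T}"
proof -
  have "((\<lambda>t::real. 1::real) has_integral (c - a)) {a..c}"
    using has_integral_const_real[of "1::real" a c] assms by simp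
  then have "((\<lambda>t. if t \<in> {a..c} then 1 else 0) has_integral (c - a)) {0..T}"
    using assms by (subst has_integral_restrict) auto
  then show ?thesis
    by (rule has_integral_spike_finite[where S="{c}", rotated 2]) auto
qed

lemma has_integral_restrict_Icc:
  fixes f :: "real \<Rightarrow> real"
  assumes "f integrable_on {0..T}" "0 \<le> a" "b \<le> T"
  shows "((\<lambda>t. if a \<le> t \<and> t \<le> b then f t else 0) has_integral (integral {a..b} f)) {0..T}"
proof -
  have "f integrable_on {a..b}"
    using assms by (intro integrable_on_subinterval[OF assms(1)]) auto
  then have "((\<lambda>t. if t \<in> {a..b} then f t else 0) has_integral (integral {a..b} f)) {0..T}"
    using assms by (subst has_integral_restrict) (auto simp: has_integral_integral)
  then show ?thesis by simp
qed

text \<open>For any two elements at least one of the two orders satisfies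
  \<open>a l \<le> a j\<close>, so symmetrizing the double sum makes every term at least 1; ties
  only help. This is the source of the factor 1/2 in the drain rate.\<close>

lemma card_pairs_le_ge_half:
  fixes a :: "'a \<Rightarrow> 'b::linorder"
  assumes "finite K"
  shows "(real (card K))\<^sup>2 \<le> 2 * (\<Sum>j\<in>K. real (card {l\<in>K. a l \<le> a j}))"
proof -
  let ?f = "\<lambda>l j. if a l \<le> a j then 1 else (0::real)"
  have c: "(\<Sum>j\<in>K. real (card {l\<in>K. a l \<le> a j})) = (\<Sum>j\<in>K. \<Sum>l\<in>K. ?f l j)"
    using assms by (simp add: sum.If_cases Int_def)
  have "(\<Sum>j\<in>K. \<Sum>l\<in>K. ?f l j) = (\<Sum>j\<in>K. \<Sum>l\<in>K. ?f j l)"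
    by (rule sum.swap)
  then have "2 * (\<Sum>j\<in>K. \<Sum>l\<in>K. ?f l j) = (\<Sum>j\<in>K. \<Sum>l\<in>K. ?f l j + ?f j l)"
    by (simp add: sum.distrib)
  moreover have "\<dots> \<ge> (\<Sum>j\<in>K. \<Sum>l\<in>K. 1)"
    by (intro sum_mono) auto
  ultimately show ?thesis
    unfolding c by (simp add: power2_eq_square)
qed

section \<open>The potential bound for equal sharing\<close>

text \<open>Abstract form of the potential argument on a finite horizon \<open>T\<close>:
  \<open>w\<close> stands for the splits, \<open>c\<close> for the dates of B-EquiSet cut off at
  \<open>T\<close>, \<open>x\<close> and \<open>p\<close> for a reference schedule and its dates.
  Facts about complete broadcasts enter only through \<open>served\<close> and \<open>waste\<close>.
  The total of \<open>N j * q j i\<close> is bounded from below by \<open>drain\<close> and from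
  above by \<open>fill\<close>.\<close>

lemma equi_share_flow_bound:
  fixes J :: "'j set" and I :: "'i set" and a c p :: "'j \<Rightarrow> real" and L :: "'i \<Rightarrow> real"
    and w :: "'j \<Rightarrow> 'i \<Rightarrow> real \<Rightarrow> real" and x :: "'i \<Rightarrow> real \<Rightarrow> real"
  defines "R \<equiv> \<lambda>t. {j\<in>J. a j \<le> t \<and> t < c j}"
  assumes fin: "finite J" "finite I"
    and a: "\<And>j. j \<in> J \<Longrightarrow> 0 \<le> a j"
    and c: "\<And>j. j \<in> J \<Longrightarrow> a j \<le> c j \<and> c j \<le> T"
    and p: "\<And>j. j \<in> J \<Longrightarrow> a j \<le> p j \<and> p j \<le> T"
    and L: "\<And>i. i \<in> I \<Longrightarrow> 0 < L i"
    and s: "0 \<le> s"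
    and w_int: "\<And>j i. j \<in> J \<Longrightarrow> i \<in> I \<Longrightarrow> w j i integrable_on {0..T}"
    and w_nonneg: "\<And>j i t. j \<in> J \<Longrightarrow> i \<in> I \<Longrightarrow> 0 \<le> t \<Longrightarrow> t \<le> T \<Longrightarrow> 0 \<le> w j i t"
    and share: "\<And>j t. 0 \<le> t \<Longrightarrow> t \<le> T \<Longrightarrow> j \<in> R t \<Longrightarrow> (\<Sum>i\<in>I. w j i t) = s / real (card (R t))"
    and x_int: "\<And>i. i \<in> I \<Longrightarrow> x i integrable_on {0..T}"
    and x_nonneg: "\<And>i t. i \<in> I \<Longrightarrow> 0 \<le> t \<Longrightarrow> t \<le> T \<Longrightarrow> 0 \<le> x i t"
    and x_sum: "\<And>t. 0 \<le> t \<Longrightarrow> t \<le> T \<Longrightarrow> (\<Sum>i\<in>I. x i t) \<le> 1"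
    and served: "\<And>j i. j \<in> J \<Longrightarrow> i \<in> I \<Longrightarrow>
        L i \<le> integral {a j..p j} (x i) \<or> (\<forall>t\<in>{0..T}. w j i t = 0)"
    and waste: "\<And>i t. i \<in> I \<Longrightarrow> 0 \<le> t \<Longrightarrow> t \<le> T \<Longrightarrow>
        (\<Sum>j | j \<in> J \<and> a j \<le> t. integral {t..T} (w j i)) \<le> 2 * L i"
  shows "(s / 2 - 2) * (\<Sum>j\<in>J. c j - a j) \<le> s * (\<Sum>j\<in>J. p j - a j)"
proof -
  \<comment> \<open>\<open>N j\<close> bounds the rank of \<open>j\<close> from above after time \<open>p j\<close>, and is at most the number of alive requests throughout \<open>[a j, p j]\<close>.\<close>
  define N where "N j = real (card {l\<in>J. a l \<le> a j \<and> p j < c l})" for j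
  \<comment> \<open>Counts the requests that the reference schedule has not yet completed, so its
    integral is the reference flow time.\<close>
  define m where "m t = (\<Sum>j\<in>J. if a j \<le> t \<and> t \<le> p j then 1 else (0::real))" for t
  \<comment> \<open>The work done on \<open>i\<close> for \<open>j\<close> once \<open>j\<close> is
    settled.\<close>
  define q where "q j i = integral {p j..T} (w j i)" for j i
  have n_int: "((\<lambda>t. real (card (R t))) has_integral (\<Sum>j\<in>J. c j - a j)) {0..T}"
  proof -
    have "real (card (R t)) = (\<Sum>j\<in>J. if a j \<le> t \<and> t < c j then 1 else 0)" for t
      using fin unfolding R_def by (simp add: sum.If_cases Int_def)
    then show ?thesis
      using fin a c by (simp only:) (intro has_integral_sum has_integral_indicator_halfopen; simp)
  qed
  have m_int: "(m has_integral (\<Sum>j\<in>J. p j - a j)) {0..T}"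
  proof -
    have "((\<lambda>t. if a j \<le> t \<and> t \<le> p j then 1 else 0) has_integral (p j - a j)) {0..T}"
      if "j \<in> J" for j
      using has_integral_restrict_Icc[of "\<lambda>_. 1" T "a j" "p j"] a[OF that] p[OF that]
      by (simp add: integrable_const_ivl)
    then show ?thesis
      unfolding m_def using fin by (intro has_integral_sum) auto
  qed
  have q_nonneg: "0 \<le> q j i" if "j \<in> J" "i \<in> I" for j i
  proof -
    have p0: "0 \<le> p j" using a[OF that(1)] p[OF that(1)] by simp
    then have "w j i integrable_on {p j..T}"
      by (intro integrable_on_subinterval[OF w_int[OF that]]) auto
    then show ?thesis
      unfolding q_def using p0 w_nonneg[OF that] by (intro integral_nonneg) auto
  qed
  have drain: "s / 2 * (real (card (R t)) - 2 * m t)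
      \<le> (\<Sum>j\<in>J. \<Sum>i\<in>I. N j * (if p j \<le> t \<and> t \<le> T then w j i t else 0))"
    if t: "t \<in> {0..T}" for t
  proof -
    \<comment> \<open>The settled alive requests; every other alive request is counted by
      \<open>m t\<close>.\<close>
    define K where "K = {j\<in>R t. p j \<le> t}"
    have finR: "finite (R t)" unfolding R_def using fin by auto
    have K: "finite K" "K \<subseteq> J" "K \<subseteq> R t" using finR by (simp add: K_def) (auto simp: K_def R_def)
    have "real (card (R t)) = real (card K) + real (card (R t - K))"
      using K finR by (metis card_Diff_subset card_mono le_add_diff_inverse of_nat_add)
    moreover have "real (card (R t - K)) \<le> m t"
    proof -
      have "card (R t - K) \<le> card {j\<in>J. a j \<le> t \<and> t \<le> p j}"
        using fin by (intro card_mono) (auto simp: K_def R_def)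
      then show ?thesis
        unfolding m_def using fin by (simp add: sum.If_cases Int_def)
    qed
    ultimately have Kn: "real (card (R t)) - m t \<le> real (card K)" by simp
    have m0: "0 \<le> m t" unfolding m_def by (intro sum_nonneg) auto
    have w0: "0 \<le> (\<Sum>i\<in>I. N j * (if p j \<le> t \<and> t \<le> T then w j i t else 0))" if "j \<in> J" for j
      using that t w_nonneg by (intro sum_nonneg mult_nonneg_nonneg) (auto simp: N_def)
    show ?thesis
    proof (cases "R t = {}")
      case True
      then have "s / 2 * (real (card (R t)) - 2 * m t) \<le> 0"
        using s m0 by (simp add: mult_nonneg_nonneg)
      also have "0 \<le> (\<Sum>j\<in>J. \<Sum>i\<in>I. N j * (if p j \<le> t \<and> t \<le> T then w j i t else 0))"
        by (rule sum_nonneg) (rule w0)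
      finally show ?thesis .
    next
      case False
      define n where "n = real (card (R t))"
      have n: "n > 0" using False finR by (simp add: n_def card_gt_0_iff)
      \<comment> \<open>Replacing the square of \<open>n - m t\<close> by this product drops the
        square of \<open>m t\<close> and leaves a factor \<open>n\<close>, which cancels against the
        share \<open>s / n\<close>. For \<open>n \<le> m t\<close> the left side is not
        positive.\<close>
      have "n * (n - 2 * m t) \<le> (real (card K))\<^sup>2"
      proof (cases "n \<le> m t")
        case True
        then have "n * (n - 2 * m t) \<le> 0" using n m0
          by (intro mult_nonneg_nonpos) auto
        then show ?thesis by (smt (verit) zero_le_power2)
      next
        case False
        then have "(n - m t)\<^sup>2 \<le> (real (card K))\<^sup>2"
          using Kn by (intro power_mono) (auto simp: n_def)
        moreover have "n * (n - 2 * m t) \<le> (n - m t)\<^sup>2"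
          by (simp add: power2_eq_square algebra_simps)
        ultimately show ?thesis by linarith
      qed
      also have "\<dots> \<le> 2 * (\<Sum>j\<in>K. real (card {l\<in>K. a l \<le> a j}))"
        using K by (intro card_pairs_le_ge_half)
      \<comment> \<open>A member \<open>l\<close> of \<open>K\<close> is alive at \<open>t\<close>
        and \<open>p j \<le> t\<close>, so \<open>p j < c l\<close>; if it arrived no later than
        \<open>j\<close>, it counts in \<open>N j\<close>.\<close>
      also have "(\<Sum>j\<in>K. real (card {l\<in>K. a l \<le> a j})) \<le> (\<Sum>j\<in>K. N j)"
      proof (intro sum_mono)
        fix j assume "j \<in> K"
        then show "real (card {l\<in>K. a l \<le> a j}) \<le> N j"
          unfolding N_def using fin
          by (intro of_nat_mono card_mono) (auto simp: K_def R_def)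
      qed
      finally have *: "n * (n - 2 * m t) \<le> 2 * (\<Sum>j\<in>K. N j)" by simp
      have "s / 2 * (n - 2 * m t) = s / (2 * n) * (n * (n - 2 * m t))" using n by simp
      also have "\<dots> \<le> s / (2 * n) * (2 * (\<Sum>j\<in>K. N j))"
        using * s n by (intro mult_left_mono) auto
      also have "\<dots> = (\<Sum>j\<in>K. N j * (s / n))" 
        unfolding sum_distrib_right[symmetric] by simp
      also have "\<dots> = (\<Sum>j\<in>K. \<Sum>i\<in>I. N j * (if p j \<le> t \<and> t \<le> T then w j i t else 0))"
      proof (intro sum.cong refl)
        fix j assume "j \<in> K"
        then show "N j * (s / n) = (\<Sum>i\<in>I. N j * (if p j \<le> t \<and> t \<le> T then w j i t else 0))"
          using share[of t j] t K by (auto simp: K_def n_def simp flip: sum_distrib_left)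
      qed
      also have "\<dots> \<le> (\<Sum>j\<in>J. \<Sum>i\<in>I. N j * (if p j \<le> t \<and> t \<le> T then w j i t else 0))"
        using K fin w0 by (intro sum_mono2) auto
      finally show ?thesis by (simp add: n_def)
    qed
  qed
  have w_int_sum: "((\<lambda>t. \<Sum>j\<in>J. \<Sum>i\<in>I. N j * (if p j \<le> t \<and> t \<le> T then w j i t else 0))
      has_integral (\<Sum>j\<in>J. \<Sum>i\<in>I. N j * q j i)) {0..T}"
    unfolding q_def using fin order_trans[OF a] p w_int
    by (intro has_integral_sum has_integral_mult_right has_integral_restrict_Icc) auto
  have n_m_int: "((\<lambda>t. s / 2 * (real (card (R t)) - 2 * m t)) has_integral
      (s / 2 * ((\<Sum>j\<in>J. c j - a j) - 2 * (\<Sum>j\<in>J. p j - a j)))) {0..T}"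
    by (intro has_integral_mult_right has_integral_diff n_int m_int)
  have lower: "s / 2 * ((\<Sum>j\<in>J. c j - a j) - 2 * (\<Sum>j\<in>J. p j - a j))
      \<le> (\<Sum>j\<in>J. \<Sum>i\<in>I. N j * q j i)"
    by (rule has_integral_le[OF n_m_int w_int_sum drain])

  \<comment> \<open>Each amount \<open>N j * q j i\<close> is charged to the reference broadcast of
    \<open>i\<close> during \<open>[a j, p j]\<close>, at a price of \<open>1 / L i\<close> per unit
    of volume.\<close>
  have fill: "(\<Sum>j\<in>J. \<Sum>i\<in>I. N j * q j i / L i * (if a j \<le> t \<and> t \<le> p j then x i t else 0))
      \<le> 2 * real (card (R t))" if t: "t \<in> {0..T}" for t
  proof -
    have "(\<Sum>j\<in>J. \<Sum>i\<in>I. N j * q j i / L i * (if a j \<le> t \<and> t \<le> p j then x i t else 0))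
        \<le> (\<Sum>j\<in>J. \<Sum>i\<in>I. (if a j \<le> t then real (card (R t)) * integral {t..T} (w j i) else 0) / L i * x i t)"
    proof (intro sum_mono)
      fix j i assume ji: "j \<in> J" "i \<in> I"
      have int_t: "w j i integrable_on {t..T}"
        using t by (intro integrable_on_subinterval[OF w_int[OF ji]]) auto
      have nn: "0 \<le> integral {t..T} (w j i)"
        using int_t t ji w_nonneg by (intro integral_nonneg) auto
      show "N j * q j i / L i * (if a j \<le> t \<and> t \<le> p j then x i t else 0)
        \<le> (if a j \<le> t then real (card (R t)) * integral {t..T} (w j i) else 0) / L i * x i t"
      proof (cases "a j \<le> t \<and> t \<le> p j")
        case True
        \<comment> \<open>A request counted in \<open>N j\<close> arrived by
          \<open>a j \<le> t\<close> and outlasts \<open>p j \<ge> t\<close>, so it is alive at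
          \<open>t\<close>.\<close>
        have "N j \<le> real (card (R t))"
          unfolding N_def R_def using fin True by (intro of_nat_mono card_mono) auto
        moreover have "q j i \<le> integral {t..T} (w j i)"
          unfolding q_def using True ji t w_nonneg p int_t
          by (intro integral_subset_le integrable_on_subinterval[OF w_int[OF ji]]) auto
        ultimately have "N j * q j i \<le> real (card (R t)) * integral {t..T} (w j i)"
          using q_nonneg[OF ji] by (intro mult_mono) auto
        then show ?thesis
          using True x_nonneg[OF ji(2), of t] L[OF ji(2)] t
          by (auto intro!: mult_right_mono divide_right_mono)
      next
        case False
        then show ?thesis
          using nn x_nonneg[OF ji(2), of t] L[OF ji(2)] t
          by auto
      qed
    qed
    \<comment> \<open>Grouping by items lets \<open>waste\<close> bound each quotient by 2; the
      rates \<open>x i t\<close> then sum to at most 1.\<close>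
    also have "\<dots> = (\<Sum>i\<in>I. real (card (R t)) * x i t *
        ((\<Sum>j | j \<in> J \<and> a j \<le> t. integral {t..T} (w j i)) / L i))"
    proof (subst sum.swap, intro sum.cong refl)
      fix i assume "i \<in> I"
      have "(\<Sum>j | j \<in> J \<and> a j \<le> t. integral {t..T} (w j i))
          = (\<Sum>j\<in>J. if a j \<le> t then integral {t..T} (w j i) else 0)"
        using fin by (simp add: sum.inter_filter)
      then show "(\<Sum>j\<in>J. (if a j \<le> t then real (card (R t)) * integral {t..T} (w j i) else 0) / L i * x i t)
        = real (card (R t)) * x i t * ((\<Sum>j | j \<in> J \<and> a j \<le> t. integral {t..T} (w j i)) / L i)"
        by (simp add: sum_distrib_left sum_divide_distrib) (intro sum.cong refl, auto)
    qed
    also have "\<dots> \<le> (\<Sum>i\<in>I. real (card (R t)) * x i t * 2)"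
    proof (intro sum_mono mult_left_mono)
      fix i assume i: "i \<in> I"
      show "(\<Sum>j | j \<in> J \<and> a j \<le> t. integral {t..T} (w j i)) / L i \<le> 2"
        using waste[OF i, of t] t L[OF i] by (simp add: divide_le_eq)
      show "0 \<le> real (card (R t)) * x i t" using x_nonneg[OF i] t by simp
    qed
    also have "\<dots> = 2 * real (card (R t)) * (\<Sum>i\<in>I. x i t)"
      by (simp add: sum_distrib_left mult_ac)
    also have "\<dots> \<le> 2 * real (card (R t)) * 1"
      using x_sum t by (intro mult_left_mono) auto
    finally show ?thesis by simp
  qed
  have "((\<lambda>t. \<Sum>j\<in>J. \<Sum>i\<in>I. N j * q j i / L i * (if a j \<le> t \<and> t \<le> p j then x i t else 0))
      has_integral (\<Sum>j\<in>J. \<Sum>i\<in>I. N j * q j i / L i * integral {a j..p j} (x i))) {0..T}"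
    using fin a p x_int
    by (intro has_integral_sum has_integral_mult_right has_integral_restrict_Icc) auto
  then have upper: "(\<Sum>j\<in>J. \<Sum>i\<in>I. N j * q j i / L i * integral {a j..p j} (x i))
      \<le> 2 * (\<Sum>j\<in>J. c j - a j)"
    using has_integral_mult_right[OF n_int, of 2] fill by (rule has_integral_le) auto
  \<comment> \<open>The window \<open>[a j, p j]\<close> contains at least \<open>L i\<close> of
    reference volume, so the charges cover the whole amount; pairs that are never worked on have
    \<open>q j i = 0\<close>.\<close>
  have "(\<Sum>j\<in>J. \<Sum>i\<in>I. N j * q j i)
      \<le> (\<Sum>j\<in>J. \<Sum>i\<in>I. N j * q j i / L i * integral {a j..p j} (x i))"
  proof (intro sum_mono)
    fix j i assume ji: "j \<in> J" "i \<in> I"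
    show "N j * q j i \<le> N j * q j i / L i * integral {a j..p j} (x i)"
    proof (cases "L i \<le> integral {a j..p j} (x i)")
      case True
      have "N j * q j i = N j * q j i / L i * L i" using L[OF ji(2)] by simp
      also have "\<dots> \<le> N j * q j i / L i * integral {a j..p j} (x i)"
        using True q_nonneg[OF ji] L[OF ji(2)] by (intro mult_left_mono) (auto simp: N_def)
      finally show ?thesis .
    next
      case False
      then have "\<forall>t\<in>{0..T}. w j i t = 0" using served[OF ji] by blast
      then have "q j i = integral {p j..T} (\<lambda>_. 0)"
        unfolding q_def using a[OF ji(1)] p[OF ji(1)] by (intro integral_cong) auto
      then show ?thesis by simp
    qed
  qed
  with lower upper show ?thesis by (simp add: algebra_simps)
qed

section \<open>Broadcast volume and item completion dates\<close>

lemma integral_Icc_split: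
  fixes f :: "real \<Rightarrow> real"
  assumes "\<And>T. 0 \<le> T \<Longrightarrow> f integrable_on {0..T}" "0 \<le> a" "a \<le> b"
  shows "integral {0..b} f = integral {0..a} f + integral {a..b} f"
  using assms Henstock_Kurzweil_Integration.integral_combine[of 0 a b f] by simp

lemma integral_Icc_mono:
  fixes f :: "real \<Rightarrow> real"
  assumes int: "\<And>T. 0 \<le> T \<Longrightarrow> f integrable_on {0..T}" and nonneg: "\<And>t. 0 \<le> t \<Longrightarrow> 0 \<le> f t"
    and "0 \<le> a" "a \<le> b"
  shows "integral {0..a} f \<le> integral {0..b} f"
  using nonneg assms(3,4) by (intro integral_subset_le int) auto

lemma integral_Icc_IVT:
  fixes f :: "real \<Rightarrow> real"
  assumes int: "\<And>T. 0 \<le> T \<Longrightarrow> f integrable_on {0..T}" and "0 \<le> a" "a \<le> b"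
    and "integral {0..a} f \<le> y" "y \<le> integral {0..b} f"
  obtains u where "a \<le> u" "u \<le> b" "integral {0..u} f = y"
proof -
  have "continuous_on {a..b} (\<lambda>u. integral {0..u} f)"
    using assms by (intro continuous_on_subset[OF indefinite_integral_continuous_1[OF int[of b]]]) auto
  then show ?thesis
    using IVT'[of "\<lambda>u. integral {0..u} f" a y b] assms that by blast
qed

text \<open>If more than \<open>k - 1\<close> lengths were out by \<open>a\<close>, broadcast
  \<open>k - 1\<close> would have ended at some \<open>u \<le> a\<close>, and any later transmission
  before \<open>a\<close> would already start broadcast \<open>k\<close>.\<close>

lemma volume_le_of_le_broadcast_start:
  assumes int: "\<And>T. 0 \<le> T \<Longrightarrow> r i integrable_on {0..T}"
    and "0 \<le> a" "0 < len P i" "1 \<le> k" and start: "ereal a \<le> broadcast_start P r i k"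
  shows "integral {0..a} (r i) \<le> real (k - 1) * len P i"
proof (rule ccontr)
  assume neg: "\<not> ?thesis"
  obtain u where u: "0 \<le> u" "u \<le> a" "integral {0..u} (r i) = real (k - 1) * len P i"
    using integral_Icc_IVT[OF int, of 0 a "real (k - 1) * len P i"] assms neg by auto
  have "broadcast_end P r i (k - 1) \<le> ereal u"
    unfolding broadcast_end_def using u by (auto intro!: Inf_lower)
  then have quiet: "r i v \<le> 0" if "u \<le> v" "v < a" for v
  proof (rule_tac ccontr)
    assume "\<not> r i v \<le> 0"
    moreover have "broadcast_end P r i (k - 1) \<le> ereal v"
      using \<open>broadcast_end P r i (k - 1) \<le> ereal u\<close> that(1)
      by (meson ereal_less_eq(3) order_trans)
    ultimately have "broadcast_start P r i k \<le> ereal v"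
      unfolding broadcast_start_def by (auto intro!: Inf_lower)
    then have "ereal a \<le> ereal v" using start by (rule order_trans[rotated])
    then show False using that by simp
  qed
  have "r i integrable_on {u..a}"
    using u by (intro integrable_on_subinterval[OF int[OF assms(2)]]) auto
  then have "(r i has_integral integral {u..a} (r i)) {u..a}"
    by (simp add: has_integral_integral)
  \<comment> \<open>The rate at \<open>a\<close> itself may be positive, because broadcast
    \<open>k\<close> may start exactly then.\<close>
  then have "((\<lambda>v. if v = a then 0 else r i v) has_integral integral {u..a} (r i)) {u..a}"
    by (rule has_integral_spike_finite[where S="{a}", rotated 2]) auto
  then have "integral {u..a} (r i) \<le> 0"
    by (rule has_integral_le[OF _ has_integral_0]) (use quiet in auto)
  then show False
    using integral_Icc_split[OF int, of u a] u neg by simp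
qed

text \<open>The strict inequality provides an actual broadcast \<open>k\<close>, whether or not the
  infimum is attained: at most \<open>k - 1\<close> lengths are out by \<open>a\<close>, and
  \<open>k\<close> lengths before \<open>b\<close>.\<close>

lemma item_completion_less_volume:
  assumes int: "\<And>T. 0 \<le> T \<Longrightarrow> r i integrable_on {0..T}"
    and nonneg: "\<And>t. 0 \<le> t \<Longrightarrow> 0 \<le> r i t"
    and "0 \<le> a" "0 < len P i" and less: "item_completion P r i a < ereal b"
  shows "integral {0..a} (r i) + len P i \<le> integral {0..b} (r i)"
proof -
  obtain k where k: "1 \<le> k" "ereal a \<le> broadcast_start P r i k" "broadcast_end P r i k < ereal b"
    using less unfolding item_completion_def by (auto simp: Inf_less_iff)
  then obtain t where t: "0 \<le> t" "t < b" "integral {0..t} (r i) = real k * len P i"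
    unfolding broadcast_end_def by (auto simp: Inf_less_iff)
  have "integral {0..a} (r i) \<le> real (k - 1) * len P i"
    using assms k by (intro volume_le_of_le_broadcast_start) auto
  then have "integral {0..a} (r i) + len P i \<le> integral {0..t} (r i)"
    using k t by (simp add: of_nat_diff algebra_simps)
  also have "\<dots> \<le> integral {0..b} (r i)"
    using t by (intro integral_Icc_mono int nonneg) auto
  finally show ?thesis .
qed

text \<open>Otherwise the volume bound with \<open>b = a\<close> would fit a full length into no
  time.\<close>

lemma item_completion_ge:
  assumes "\<And>T. 0 \<le> T \<Longrightarrow> r i integrable_on {0..T}" "\<And>t. 0 \<le> t \<Longrightarrow> 0 \<le> r i t"
    and "0 \<le> a" "0 < len P i"
  shows "ereal a \<le> item_completion P r i a"
proof (rule ccontr)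
  assume "\<not> ?thesis"
  then have "integral {0..a} (r i) + len P i \<le> integral {0..a} (r i)"
    using assms by (intro item_completion_less_volume) auto
  then show False using assms(4) by simp
qed

text \<open>The strict version applies at \<open>b + d\<close> for every \<open>d > 0\<close>, and
  bounded rates make the surplus volume arbitrarily small.\<close>

lemma item_completion_le_volume:
  assumes int: "\<And>T. 0 \<le> T \<Longrightarrow> r i integrable_on {0..T}"
    and bounds: "\<And>t. 0 \<le> t \<Longrightarrow> 0 \<le> r i t \<and> r i t \<le> s"
    and "0 \<le> a" "0 < len P i" and le: "item_completion P r i a \<le> ereal b" and "a \<le> b"
  shows "len P i \<le> integral {a..b} (r i)"
proof (rule field_le_epsilon)
  fix e :: real assume e: "0 < e"
  have s: "0 \<le> s" using bounds[of 0] by simp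
  \<comment> \<open>The denominator \<open>s + 1\<close> covers the case
    \<open>s = 0\<close>.\<close>
  define d where "d = e / (s + 1)"
  have d: "0 < d" "d * s \<le> e"
    using e s by (auto simp: d_def field_simps)
  have "item_completion P r i a < ereal (b + d)"
    using le d by (meson ereal_less_eq(3) less_add_same_cancel1 less_ereal.simps(1) order_le_less_trans)
  then have "integral {0..a} (r i) + len P i \<le> integral {0..b + d} (r i)"
    using assms by (intro item_completion_less_volume) auto
  also have "\<dots> = integral {0..a} (r i) + integral {a..b} (r i) + integral {b..b + d} (r i)"
    using integral_Icc_split[OF int, of a b] integral_Icc_split[OF int, of b "b + d"] assms d by simp
  also have "integral {b..b + d} (r i) \<le> integral {b..b + d} (\<lambda>_. s)"
    using assms d
    by (intro integral_le integrable_on_subinterval[OF int[of "b + d"]]) auto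
  also have "\<dots> = d * s" using d by simp
  finally show "len P i \<le> integral {a..b} (r i) + e" using d by simp
qed

text \<open>A broadcast in progress at time \<open>t\<close> is useless for a request that arrived during it, but the
  next one starts no earlier than \<open>t\<close>.\<close>

lemma item_completion_le_next_broadcast:
  assumes int: "\<And>T. 0 \<le> T \<Longrightarrow> r i integrable_on {0..T}"
    and nonneg: "\<And>t. 0 \<le> t \<Longrightarrow> 0 \<le> r i t"
    and "a \<le> t" "0 \<le> t" "1 \<le> k" "integral {0..t} (r i) < real k * len P i"
    and u: "0 \<le> u" "integral {0..u} (r i) = real (k + 1) * len P i"
  shows "item_completion P r i a \<le> ereal u"
proof -
  have "t \<le> v" if "0 \<le> v" "integral {0..v} (r i) = real k * len P i" for v
  proof (rule ccontr)
    assume "\<not> t \<le> v"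
    then have "integral {0..v} (r i) \<le> integral {0..t} (r i)"
      using that by (intro integral_Icc_mono int nonneg) auto
    then show False using that assms(6) by simp
  qed
  then have "ereal t \<le> broadcast_end P r i k"
    unfolding broadcast_end_def using \<open>1 \<le> k\<close> by (auto intro!: Inf_greatest)
  moreover have "broadcast_end P r i k \<le> broadcast_start P r i (k + 1)"
    unfolding broadcast_start_def by (auto intro!: Inf_greatest)
  moreover have "ereal a \<le> ereal t" using assms(3) by simp
  ultimately have "ereal a \<le> broadcast_start P r i (k + 1)" by (meson order_trans)
  then have "item_completion P r i a \<le> broadcast_end P r i (k + 1)"
    unfolding item_completion_def by (intro Inf_lower CollectI exI[of _ "k + 1"]) simp
  also have "\<dots> \<le> ereal u"
    unfolding broadcast_end_def using u by (auto intro!: Inf_lower)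
  finally show ?thesis .
qed

section \<open>Alive requests and request completion\<close>

text \<open>Turns the itemwise notion of being alive into a time window per request, the form of
  \<open>R\<close> in \<open>equi_share_flow_bound\<close>.\<close>

lemma alive_requests_eq:
  assumes "valid_instance P"
  shows "alive_requests P r t = {j \<in> requests P. arr P j \<le> t \<and> ereal t < completion P r j}"
proof -
  have "ereal t < completion P r j \<longleftrightarrow> (\<exists>i\<in>req P j. ereal t < item_completion P r i (arr P j))"
    if "j \<in> requests P" for j
  proof -
    have "finite (req P j)" "req P j \<noteq> {}"
      using assms that finite_subset[of "req P j" "items P"] by (auto simp: valid_instance_def)
    then show ?thesis unfolding completion_def by (subst Max_gr_iff) auto
  qed
  then show ?thesis by (auto simp: alive_requests_def alive_item_def)
qed

lemma item_completion_le_completion: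
  assumes "valid_instance P" "j \<in> requests P" "i \<in> req P j"
  shows "item_completion P r i (arr P j) \<le> completion P r j"
proof -
  have "finite (req P j)"
    using assms finite_subset[of "req P j" "items P"] by (auto simp: valid_instance_def)
  then show ?thesis unfolding completion_def using assms by (intro Max_ge) auto
qed

lemma arr_le_completion:
  assumes P: "valid_instance P" and j: "j \<in> requests P"
    and int: "\<And>i T. i \<in> items P \<Longrightarrow> 0 \<le> T \<Longrightarrow> r i integrable_on {0..T}"
    and nonneg: "\<And>i t. i \<in> items P \<Longrightarrow> 0 \<le> t \<Longrightarrow> 0 \<le> r i t"
  shows "ereal (arr P j) \<le> completion P r j"
proof -
  obtain i where i: "i \<in> req P j" "i \<in> items P"
    using P j unfolding valid_instance_def by blast
  then have "ereal (arr P j) \<le> item_completion P r i (arr P j)"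
    using P j int[OF i(2)] nonneg[OF i(2)] unfolding valid_instance_def
    by (intro item_completion_ge) blast+
  then show ?thesis
    using item_completion_le_completion[OF P j i(1)] by (rule order_trans)
qed

section \<open>The work done by B-EquiSet\<close>

text \<open>Splits vanish off the alive pairs, so both sums may run over index sets that do not vary
  with \<open>t\<close> and can be integrated termwise.\<close>

lemma B_EquiSet_splits:
  assumes P: "valid_instance P" and "B_EquiSet P s r"
  obtains w where
    "\<And>j i T. j \<in> requests P \<Longrightarrow> i \<in> items P \<Longrightarrow> 0 \<le> T \<Longrightarrow> w j i integrable_on {0..T}"
    "\<And>j i t. j \<in> requests P \<Longrightarrow> i \<in> items P \<Longrightarrow> 0 \<le> t \<Longrightarrow> 0 \<le> w j i t"
    "\<And>j i t. j \<in> requests P \<Longrightarrow> i \<in> items P \<Longrightarrow> 0 \<le> t \<Longrightarrow> \<not> alive_item P r j t i \<Longrightarrow> w j i t = 0"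
    "\<And>j t. 0 \<le> t \<Longrightarrow> j \<in> alive_requests P r t \<Longrightarrow>
       (\<Sum>i\<in>items P. w j i t) = s / real (card (alive_requests P r t))"
    "\<And>i t. i \<in> items P \<Longrightarrow> 0 \<le> t \<Longrightarrow> r i t = (\<Sum>j\<in>requests P. w j i t)"
proof -
  obtain w where w:
    "\<forall>j\<in>requests P. \<forall>i\<in>items P. \<forall>T\<ge>0. w j i integrable_on {0..T}"
    "\<forall>t\<ge>0. \<forall>j\<in>requests P. \<forall>i\<in>items P.
           0 \<le> w j i t \<and> (\<not> alive_item P r j t i \<longrightarrow> w j i t = 0)"
    "\<forall>t\<ge>0. \<forall>j\<in>alive_requests P r t.
           (\<Sum>i | alive_item P r j t i. w j i t) = s / real (card (alive_requests P r t))"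
    "\<forall>t\<ge>0. \<forall>i\<in>items P.
           r i t = (\<Sum>j | j \<in> alive_requests P r t \<and> alive_item P r j t i. w j i t)"
    using assms(2) unfolding B_EquiSet_def by blast
  have "(\<Sum>i\<in>items P. w j i t) = s / real (card (alive_requests P r t))"
    if "0 \<le> t" "j \<in> alive_requests P r t" for j t
  proof -
    have j: "j \<in> requests P" using that by (auto simp: alive_requests_def)
    have "(\<Sum>i | alive_item P r j t i. w j i t) = (\<Sum>i\<in>items P. w j i t)"
      using w(2) that(1) j P
      by (intro sum.mono_neutral_left) (auto simp: alive_item_def valid_instance_def)
    then show ?thesis using w(3) that by auto
  qed
  moreover have "r i t = (\<Sum>j\<in>requests P. w j i t)" if "i \<in> items P" "0 \<le> t" for i t
  proof -
    have "(\<Sum>j | j \<in> alive_requests P r t \<and> alive_item P r j t i. w j i t) = (\<Sum>j\<in>requests P. w j i t)"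
    proof (intro sum.mono_neutral_left ballI)
      fix j assume "j \<in> requests P - {j. j \<in> alive_requests P r t \<and> alive_item P r j t i}"
      then have "j \<in> requests P" "\<not> alive_item P r j t i"
        unfolding alive_requests_def by blast+
      then show "w j i t = 0" using w(2) that by blast
    qed (auto simp: alive_requests_def)
    then show ?thesis using w(4) that by auto
  qed
  ultimately show ?thesis using w(1,2) by (intro that[of w]) auto
qed

text \<open>Supplies \<open>waste\<close>: one broadcast of \<open>i\<close> may be in progress at
  \<open>t\<close>, and the next one can be downloaded by every request that arrived by
  \<open>t\<close>. After these two, \<open>i\<close> is dead for all of them.\<close>

lemma volume_for_arrived_requests_le:
  assumes P: "valid_instance P" and i: "i \<in> items P" and t: "0 \<le> t" "t \<le> T"
    and w_int: "\<And>j T. j \<in> requests P \<Longrightarrow> 0 \<le> T \<Longrightarrow> w j integrable_on {0..T}"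
    and w_nonneg: "\<And>j t. j \<in> requests P \<Longrightarrow> 0 \<le> t \<Longrightarrow> 0 \<le> w j t"
    and dead: "\<And>j t. j \<in> requests P \<Longrightarrow> 0 \<le> t \<Longrightarrow> \<not> alive_item P r j t i \<Longrightarrow> w j t = 0"
    and rate: "\<And>t. 0 \<le> t \<Longrightarrow> r i t = (\<Sum>j\<in>requests P. w j t)"
  shows "(\<Sum>j | j \<in> requests P \<and> arr P j \<le> t. integral {t..T} (w j)) \<le> 2 * len P i"
proof -
  have len: "0 < len P i" using P i by (auto simp: valid_instance_def)
  have int: "r i integrable_on {0..T'}" if "0 \<le> T'" for T'
  proof -
    have "(\<lambda>t. \<Sum>j\<in>requests P. w j t) integrable_on {0..T'}"
      using w_int that by (intro integrable_sum) auto
    then show ?thesis by (rule integrable_eq) (auto simp: rate)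
  qed
  have nonneg: "0 \<le> r i t'" if "0 \<le> t'" for t'
    using rate[OF that] w_nonneg that by (auto intro!: sum_nonneg)
  define V where "V u = integral {0..u} (r i)" for u
  have V0: "0 \<le> V t" unfolding V_def using int nonneg t by (intro integral_nonneg) auto
  \<comment> \<open>The number of the broadcast in progress at \<open>t\<close>, or of the next one
    if \<open>V t\<close> is a whole number of lengths.\<close>
  define k where "k = nat \<lfloor>V t / len P i\<rfloor> + 1"
  have "real k = of_int \<lfloor>V t / len P i\<rfloor> + 1"
    unfolding k_def using V0 len by simp
  then have "real k - 1 \<le> V t / len P i" "V t / len P i < real k" by linarith+
  then have k: "(real k - 1) * len P i \<le> V t" "V t < real k * len P i"
    using len by (simp_all add: field_simps)
  \<comment> \<open>\<open>T'\<close> is a time at which \<open>k + 1\<close> lengths are out, or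
    \<open>T\<close> if no more than that is out by \<open>T\<close>. Excluding
    \<open>u = T'\<close> makes the claim vacuous for \<open>T' = T\<close> and does not affect
    integrals.\<close>
  have "\<exists>T'. t \<le> T' \<and> T' \<le> T \<and> V T' \<le> (real k + 1) * len P i \<and>
      (\<forall>j u. j \<in> requests P \<longrightarrow> arr P j \<le> t \<longrightarrow> T' \<le> u \<longrightarrow> u \<le> T \<longrightarrow> u \<noteq> T' \<longrightarrow> w j u = 0)"
  proof (cases "V T \<le> (real k + 1) * len P i")
    case True
    then show ?thesis using t by (intro exI[of _ T]) auto
  next
    case False
    have "V t \<le> (real k + 1) * len P i" using k(2) len by (simp add: algebra_simps)
    then obtain T' where T': "t \<le> T'" "T' \<le> T" "V T' = (real k + 1) * len P i"
      using integral_Icc_IVT[OF int t, of "(real k + 1) * len P i"] False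
      unfolding V_def by auto
    have "w j u = 0" if "j \<in> requests P" "arr P j \<le> t" "T' \<le> u" for j u
    proof -
      have "item_completion P r i (arr P j) \<le> ereal T'"
      proof (rule item_completion_le_next_broadcast[where k=k and t=t])
        show "1 \<le> k" by (simp add: k_def)
        show "integral {0..t} (r i) < real k * len P i" using k by (simp add: V_def)
        show "0 \<le> T'" using t T' by simp
        show "integral {0..T'} (r i) = real (k + 1) * len P i" using T'(3) by (simp add: V_def add.commute)
      qed (fact int nonneg that(2) t(1))+
      also have "\<dots> \<le> ereal u" using that by simp
      finally show ?thesis
        using that t T' by (intro dead) (auto simp: alive_item_def)
    qed
    then show ?thesis using T' by (intro exI[of _ T']) auto
  qed
  then obtain T' where T': "t \<le> T'" "T' \<le> T" "V T' \<le> (real k + 1) * len P i"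
    and over: "\<And>j u. j \<in> requests P \<Longrightarrow> arr P j \<le> t \<Longrightarrow> T' \<le> u \<Longrightarrow> u \<le> T \<Longrightarrow> u \<noteq> T' \<Longrightarrow> w j u = 0"
    by blast
  have w_int': "w j integrable_on {t..T'}" if "j \<in> requests P" for j
    using that t T' by (intro integrable_on_subinterval[OF w_int[of j T']]) auto
  have "integral {t..T} (w j) = integral {t..T'} (w j)" if "j \<in> requests P" "arr P j \<le> t" for j
  proof -
    have "w j integrable_on {t..T}"
      using that t T' by (intro integrable_on_subinterval[OF w_int[of j T]]) auto
    then have "integral {t..T} (w j) = integral {t..T'} (w j) + integral {T'..T} (w j)"
      using T' by (intro Henstock_Kurzweil_Integration.integral_combine[symmetric]) auto
    moreover have "integral {T'..T} (w j) = integral {T'..T} (\<lambda>_. 0)"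
      using over that by (intro integral_spike[of "{T'}"]) auto
    ultimately show ?thesis by simp
  qed
  then have "(\<Sum>j | j \<in> requests P \<and> arr P j \<le> t. integral {t..T} (w j))
      = (\<Sum>j | j \<in> requests P \<and> arr P j \<le> t. integral {t..T'} (w j))"
    by (intro sum.cong) auto
  also have "\<dots> \<le> (\<Sum>j\<in>requests P. integral {t..T'} (w j))"
    using w_int' w_nonneg t by (intro sum_mono2 integral_nonneg) auto
  also have "\<dots> = integral {t..T'} (\<lambda>u. \<Sum>j\<in>requests P. w j u)"
    using w_int' by (intro integral_sum[symmetric]) auto
  also have "\<dots> = integral {t..T'} (r i)"
    using t rate by (intro integral_cong) auto
  also have "\<dots> = V T' - V t"
    using integral_Icc_split[OF int t(1) T'(1)] by (simp add: V_def)
  also have "\<dots> \<le> 2 * len P i" using T' k by (simp add: algebra_simps)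
  finally show ?thesis .
qed

section \<open>The competitive bound\<close>

text \<open>The ratio is \<open>s / (s / 2 - 2)\<close> from the potential bound. The dates of
  B-EquiSet are not known to be finite beforehand, so they are first cut off at \<open>T\<close>;
  the bound is uniform in \<open>T\<close>, which then yields finiteness.\<close>

lemma B_EquiSet_flow_time_le:
  assumes P: "valid_instance P" and B: "B_EquiSet P s r" and s: "4 < s"
    and x: "is_schedule P 1 x"
  shows "flow_time P r \<le> ereal (2 * s / (s - 4)) * flow_time P x"
proof (cases "flow_time P x = \<infinity>")
  case True
  then show ?thesis using s by simp
next
  case False
  obtain w where w_int: "\<And>j i T. j \<in> requests P \<Longrightarrow> i \<in> items P \<Longrightarrow> 0 \<le> T \<Longrightarrow> w j i integrable_on {0..T}"
    and w_nonneg: "\<And>j i t. j \<in> requests P \<Longrightarrow> i \<in> items P \<Longrightarrow> 0 \<le> t \<Longrightarrow> 0 \<le> w j i t"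
    and dead: "\<And>j i t. j \<in> requests P \<Longrightarrow> i \<in> items P \<Longrightarrow> 0 \<le> t \<Longrightarrow> \<not> alive_item P r j t i \<Longrightarrow> w j i t = 0"
    and share: "\<And>j t. 0 \<le> t \<Longrightarrow> j \<in> alive_requests P r t \<Longrightarrow>
       (\<Sum>i\<in>items P. w j i t) = s / real (card (alive_requests P r t))"
    and rate: "\<And>i t. i \<in> items P \<Longrightarrow> 0 \<le> t \<Longrightarrow> r i t = (\<Sum>j\<in>requests P. w j i t)"
    using B_EquiSet_splits[OF P B] by blast
  have r_int: "r i integrable_on {0..T}" if "i \<in> items P" "0 \<le> T" for i T
  proof -
    have "(\<lambda>t. \<Sum>j\<in>requests P. w j i t) integrable_on {0..T}"
      using w_int that by (intro integrable_sum) auto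
    then show ?thesis by (rule integrable_eq) (use rate that in auto)
  qed
  have r_nonneg: "0 \<le> r i t" if "i \<in> items P" "0 \<le> t" for i t
    using rate[OF that] w_nonneg that by (auto intro!: sum_nonneg)
  have x_int: "x i integrable_on {0..T}" if "i \<in> items P" "0 \<le> T" for i T
    using x that by (auto simp: is_schedule_def)
  have x_bounds: "0 \<le> x i t \<and> x i t \<le> 1" if "i \<in> items P" "0 \<le> t" for i t
    using x that by (auto simp: is_schedule_def)
  have arr: "0 \<le> arr P j" if "j \<in> requests P" for j
    using P that by (auto simp: valid_instance_def)
  have arr_r: "ereal (arr P j) \<le> completion P r j" if "j \<in> requests P" for j
    using P that r_int r_nonneg by (intro arr_le_completion) auto
  have arr_x: "ereal (arr P j) \<le> completion P x j" if "j \<in> requests P" for j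
    using P that x_int x_bounds by (intro arr_le_completion) auto
  have fin_x: "completion P x j \<noteq> \<infinity>" if "j \<in> requests P" for j
  proof
    assume "completion P x j = \<infinity>"
    then have "completion P x j - ereal (arr P j) = \<infinity>" by simp
    then show False using False that unfolding flow_time_def sum_Pinfty by blast
  qed
  define p where "p j = real_of_ereal (completion P x j)" for j
  have p: "completion P x j = ereal (p j)" "arr P j \<le> p j" if "j \<in> requests P" for j
    unfolding p_def using arr_x[OF that] fin_x[OF that] by (cases "completion P x j"; simp)+
  define G where "G = (\<Sum>j\<in>requests P. p j - arr P j)"
  have flow_x: "flow_time P x = ereal G"
    unfolding flow_time_def G_def using p by simp
  define c where "c T j = real_of_ereal (min (completion P r j) (ereal T))" for T j
  have bound: "(\<Sum>j\<in>requests P. c T j - arr P j) \<le> 2 * s / (s - 4) * G"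
    and c: "\<And>j. j \<in> requests P \<Longrightarrow> ereal (c T j) = min (completion P r j) (ereal T)"
    and arr_c: "\<And>j. j \<in> requests P \<Longrightarrow> arr P j \<le> c T j"
    if T: "\<And>j. j \<in> requests P \<Longrightarrow> p j \<le> T" for T
  proof -
    have arr_T: "arr P j \<le> T" if "j \<in> requests P" for j
      using T[OF that] p(2)[OF that] by simp
    show c: "ereal (c T j) = min (completion P r j) (ereal T)" if "j \<in> requests P" for j
      using arr_r[OF that] unfolding c_def by (cases "completion P r j") (auto simp: min_def)
    show arr_c: "arr P j \<le> c T j" if "j \<in> requests P" for j
    proof -
      have "ereal (arr P j) \<le> ereal (c T j)" using c arr_r arr_T that by simp
      then show ?thesis by simp
    qed
    have c_le: "c T j \<le> T" if "j \<in> requests P" for j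
    proof -
      have "ereal (c T j) \<le> ereal T" using c that by simp
      then show ?thesis by simp
    qed
    have alive: "alive_requests P r t = {j\<in>requests P. arr P j \<le> t \<and> t < c T j}" if "t < T" for t
    proof -
      have "ereal t < completion P r j \<longleftrightarrow> t < c T j" if "j \<in> requests P" for j
      proof -
        have "t < c T j \<longleftrightarrow> ereal t < ereal (c T j)" by simp
        then show ?thesis unfolding c[OF that] using \<open>t < T\<close> by simp
      qed
      then show ?thesis unfolding alive_requests_eq[OF P] by auto
    qed
    have "(s / 2 - 2) * (\<Sum>j\<in>requests P. c T j - arr P j) \<le> s * G"
      unfolding G_def
    proof (rule equi_share_flow_bound[where I="items P" and T=T and L="len P" and w=w and x=x])
      fix j t assume "0 \<le> t" "t \<le> T" and j: "j \<in> {j\<in>requests P. arr P j \<le> t \<and> t < c T j}"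
      \<comment> \<open>No cut-off date exceeds \<open>T\<close>, so the membership of
        \<open>j\<close> excludes \<open>t = T\<close>, where the cut-off set and the set of alive
        requests may differ.\<close>
      then have "t < T" using c_le by force
      show "(\<Sum>i\<in>items P. w j i t) = s / real (card {j\<in>requests P. arr P j \<le> t \<and> t < c T j})"
        using share[of t j] j \<open>0 \<le> t\<close> unfolding alive[OF \<open>t < T\<close>] by blast
    next
      fix j i assume ji: "j \<in> requests P" "i \<in> items P"
      show "len P i \<le> integral {arr P j..p j} (x i) \<or> (\<forall>t\<in>{0..T}. w j i t = 0)"
      proof (cases "i \<in> req P j")
        case True
        have "len P i \<le> integral {arr P j..p j} (x i)"
        proof (rule item_completion_le_volume)
          show "item_completion P x i (arr P j) \<le> ereal (p j)"
            using item_completion_le_completion[OF P ji(1) True, of x] p(1)[OF ji(1)] by simp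
          show "0 < len P i" using P ji by (auto simp: valid_instance_def)
          show "0 \<le> x i t \<and> x i t \<le> 1" if "0 \<le> t" for t using x_bounds ji that by blast
        qed (use ji x_int arr p in auto)
        then show ?thesis ..
      next
        case False
        then show ?thesis using dead[OF ji] by (auto simp: alive_item_def)
      qed
    next
      fix i t assume "i \<in> items P" "0 \<le> t" "t \<le> T"
      then show "(\<Sum>j | j \<in> requests P \<and> arr P j \<le> t. integral {t..T} (w j i)) \<le> 2 * len P i"
        using P w_int w_nonneg dead rate by (intro volume_for_arrived_requests_le[where r=r]) auto
    next
      fix t assume "0 \<le> t" "t \<le> T"
      then show "(\<Sum>i\<in>items P. x i t) \<le> 1" using x by (auto simp: is_schedule_def)
    next
      fix j i assume "j \<in> requests P" "i \<in> items P"
      moreover then have "0 \<le> T" using arr arr_T by force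
      ultimately show "w j i integrable_on {0..T}" by (intro w_int)
    next
      fix i assume i: "i \<in> items P"
      \<comment> \<open>Without requests \<open>T\<close> may be negative; the interval is then
        empty.\<close>
      show "x i integrable_on {0..T}"
        using x_int[OF i, of T] by (cases "0 \<le> T") auto
    qed (use s arr arr_c c_le p T w_nonneg x_bounds P in \<open>auto simp: valid_instance_def\<close>)
    then show "(\<Sum>j\<in>requests P. c T j - arr P j) \<le> 2 * s / (s - 4) * G"
      using s by (simp add: field_simps)
  qed
  define K where "K = 2 * s / (s - 4) * G"
  have T0: "p j \<le> (\<Sum>j\<in>requests P. p j)" if "j \<in> requests P" for j
    using that p arr by (intro member_le_sum) (auto intro: order_trans)
  have fin_r: "completion P r j \<noteq> \<infinity>" if j: "j \<in> requests P" for j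
  proof
    assume inf: "completion P r j = \<infinity>"
    \<comment> \<open>An infinite date is cut off to \<open>T\<close>, so request \<open>j\<close>
      alone would contribute at least \<open>K + 1\<close>, more than the bound allows.\<close>
    define T where "T = max (\<Sum>j\<in>requests P. p j) (K + arr P j + 1)"
    have T: "p l \<le> T" if "l \<in> requests P" for l
      using T0[OF that] by (simp add: T_def)
    have "c T j - arr P j \<le> (\<Sum>l\<in>requests P. c T l - arr P l)"
      using arr_c[OF T] j by (intro member_le_sum) auto
    also have "\<dots> \<le> K" using bound[OF T] by (simp add: K_def)
    finally have "c T j \<le> K + arr P j" by simp
    moreover have "c T j = T" using c[OF T j] inf by simp
    ultimately show False by (simp add: T_def)
  qed
  define d where "d j = real_of_ereal (completion P r j)" for j
  have d: "completion P r j = ereal (d j)" "0 \<le> d j" if "j \<in> requests P" for j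
    unfolding d_def using arr_r[OF that] fin_r[OF that] arr[OF that]
    by (cases "completion P r j"; simp)+
  \<comment> \<open>Late enough to cut off nothing; the sums dominate each date because all dates
    are nonnegative.\<close>
  define T where "T = (\<Sum>j\<in>requests P. p j) + (\<Sum>j\<in>requests P. d j)"
  have d_le: "d j \<le> (\<Sum>j\<in>requests P. d j)" if "j \<in> requests P" for j
    using that d by (intro member_le_sum) auto
  have p_le: "p j \<le> T" if "j \<in> requests P" for j
    using T0[OF that] d_le[OF that] d(2)[OF that] by (simp add: T_def)
  have "c T j = d j" if "j \<in> requests P" for j
  proof -
    have "d j \<le> T" using T0[OF that] d_le[OF that] p(2)[OF that] arr[OF that] by (simp add: T_def)
    then show ?thesis using c[OF p_le that] d(1)[OF that] by simp
  qed
  then have "(\<Sum>j\<in>requests P. d j - arr P j) \<le> K"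
    using bound[OF p_le] by (simp add: K_def)
  moreover have "flow_time P r = ereal (\<Sum>j\<in>requests P. d j - arr P j)"
    unfolding flow_time_def using d by simp
  ultimately show ?thesis unfolding flow_x by (simp add: K_def)
qed

lemma B_EquiSet_speed_competitive:
  assumes "4 < s" and "2 * s / (s - 4) \<le> C"
  shows "speed_competitive B_EquiSet s C"
  unfolding speed_competitive_def
proof (intro allI impI)
  fix P r assume P: "valid_instance P" and B: "B_EquiSet P s r"
  have K: "0 < 2 * s / (s - 4)" using assms by simp
  then have C: "0 < C" using assms(2) by linarith
  \<comment> \<open>Division by \<open>C\<close> makes the left side a lower bound of the unit-speed
    flow times, so it passes to the infimum \<open>BOPT 1 P\<close>, attained or not.\<close>
  have "flow_time P r / ereal C \<le> flow_time P x" if x: "is_schedule P 1 x" for x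
  proof -
    \<comment> \<open>Nonnegativity permits enlarging the ratio to \<open>C\<close>.\<close>
    have "0 \<le> flow_time P x"
      unfolding flow_time_def
    proof (intro sum_nonneg)
      fix j assume "j \<in> requests P"
      then have "ereal (arr P j) \<le> completion P x j"
        using x unfolding is_schedule_def by (intro arr_le_completion P) blast+
      then show "0 \<le> completion P x j - ereal (arr P j)"
        by (simp add: ereal_diff_positive)
    qed
    then have "ereal (2 * s / (s - 4)) * flow_time P x \<le> ereal C * flow_time P x"
      using assms by (intro ereal_mult_right_mono) auto
    with B_EquiSet_flow_time_le[OF P B assms(1) x] have "flow_time P r \<le> ereal C * flow_time P x"
      by (rule order_trans)
    then show ?thesis using C by (simp add: ereal_divide_le_pos)
  qed
  then have "flow_time P r / ereal C \<le> BOPT 1 P"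
    unfolding BOPT_def by (auto intro!: Inf_greatest)
  then show "flow_time P r \<le> ereal C * BOPT 1 P"
    using C by (simp add: ereal_divide_le_pos)
qed

theorem theorem1:
  fixes \<delta> \<epsilon> :: real
  assumes "\<delta> > 0" and "\<epsilon> > 0"
  shows "speed_competitive B_EquiSet ((1 + \<delta>) * (4 + \<epsilon>)) ((2 + 8 / \<epsilon>) * (1 + 1 / \<delta>))"
proof (rule B_EquiSet_speed_competitive)
  define s where "s = (1 + \<delta>) * (4 + \<epsilon>)"
  have s: "4 + \<epsilon> \<le> s" using assms by (simp add: s_def algebra_simps)
  then show "4 < (1 + \<delta>) * (4 + \<epsilon>)" using assms unfolding s_def by linarith
  \<comment> \<open>In this form the ratio is visibly decreasing in \<open>s\<close>, and
    \<open>s - 4 \<ge> \<epsilon>\<close>; the factor \<open>1 + 1 / \<delta>\<close> is at least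
    1.\<close>
  have "2 * s / (s - 4) = 2 + 8 / (s - 4)" using s assms by (simp add: field_simps)
  also have "\<dots> \<le> 2 + 8 / \<epsilon>" using s assms by (intro add_left_mono divide_left_mono) auto
  also have "\<dots> \<le> (2 + 8 / \<epsilon>) * (1 + 1 / \<delta>)" using assms by (simp add: field_simps)
  finally show "2 * ((1 + \<delta>) * (4 + \<epsilon>)) / ((1 + \<delta>) * (4 + \<epsilon>) - 4) \<le> (2 + 8 / \<epsilon>) * (1 + 1 / \<delta>)"
    by (simp add: s_def)
qed

end
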